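(* There exist formally self-dual additive $(13,2^{13},6)$ codes over $\mathrm{GF}(4)$. More precisely, let $\mathcal{C}_{13,1}$ be the additive code generated by all cyclic shifts of the vector $(\omega,1,0,1,0,0,1,1,1,0,0,0,0)$ and $\mathcal{C}_{13,2}$ the additive code generated by all cyclic shifts of the vector $(\omega,1,1,1,0,1,1,1,1,1,0,1,0)$. Then both are formally self-dual $(13,2^{13},6)$ codes, $|\mathrm{Aut}(\mathcal{C}_{13,1})|=13$, $|\mathrm{Aut}(\mathcal{C}_{13,2})|=78$, and both have the weight enumerator $$W_{13}(1,y)=1+247y^6+481y^7+936y^8+1625y^9+2197y^{10}+1755y^{11}+715y^{12}+235y^{13}.$$
   Context: $\mathrm{GF}(4)=\{0,1,\omega,\omega^2\}$ with $\omega^2=\omega+1$; conjugation is $\overline{x}=x^2$ and $\mathrm{Tr}(x)=x+\overline{x}$. An additive $(n,2^k,d)$ code over $\mathrm{GF}(4)$ is an additive subgroup of $\mathrm{GF}(4)^n$ with $2^k$ elements and minimum nonzero Hamming weight $d$; "generated" means spanned additively (over $\mathrm{GF}(2)$). The weight enumerator is $W_{\mathcal{C}}(x,y)=\sum_{i=0}^n A_i x^{n-i}y^i$, with $A_i$ the number of codewords of Hamming weight $i$. The dual is $\mathcal{C}^\perp=\{\boldsymbol{u}\in\mathrm{GF}(4)^n \mid \sum_i\mathrm{Tr}(u_i\overline{c_i})=0 \text{ for all } \boldsymbol{c}\in\mathcal{C}\}$; $\mathcal{C}$ is formally self-dual if $W_{\mathcal{C}}=W_{\mathcal{C}^\perp}$.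 $\mathrm{Aut}(\mathcal{C})$ is the group of those maps, among the $6^n n!$ maps of $\mathrm{GF}(4)^n$ consisting of a permutation of coordinates, followed by multiplication of individual coordinates by nonzero elements of $\mathrm{GF}(4)$, followed by conjugation of some of the coordinates, that map $\mathcal{C}$ onto itself. *)

theory Defs
  imports
    "HOL-Analysis.Cartesian_Space"
    "HOL-Computational_Algebra.Polynomial"
    "HOL-Computational_Algebra.Group_Closure"
begin

section \<open>The field with four elements\<close>

datatype gf4 = G0 | G1 | Gw | Gw2

instance gf4 :: finite
proof
  have "(UNIV :: gf4 set) = {G0, G1, Gw, Gw2}"
    using gf4.exhaust by blast
  then show "finite (UNIV :: gf4 set)"
    by (rule ssubst) simp
qed

instantiation gf4 :: field
begin

definition zero_gf4 :: gf4 where "0 = G0"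

definition one_gf4 :: gf4 where "1 = G1"

fun plus_gf4 :: "gf4 \<Rightarrow> gf4 \<Rightarrow> gf4" where
  "G0 + b = b"
| "a + G0 = a"
| "G1 + G1 = G0"
| "G1 + Gw = Gw2"
| "G1 + Gw2 = Gw"
| "Gw + G1 = Gw2"
| "Gw + Gw = G0"
| "Gw + Gw2 = G1"
| "Gw2 + G1 = Gw"
| "Gw2 + Gw = G1"
| "Gw2 + Gw2 = G0"

definition uminus_gf4 :: "gf4 \<Rightarrow> gf4" where "- (a :: gf4) = a"

definition minus_gf4 :: "gf4 \<Rightarrow> gf4 \<Rightarrow> gf4" where "(a :: gf4) - b = a + b"

fun times_gf4 :: "gf4 \<Rightarrow> gf4 \<Rightarrow> gf4" where
  "G0 * b = G0"
| "a * G0 = G0"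
| "G1 * b = b"
| "a * G1 = a"
| "Gw * Gw = Gw2"
| "Gw * Gw2 = G1"
| "Gw2 * Gw = G1"
| "Gw2 * Gw2 = Gw"

fun inverse_gf4 :: "gf4 \<Rightarrow> gf4" where
  "inverse G0 = G0"
| "inverse G1 = G1"
| "inverse Gw = Gw2"
| "inverse Gw2 = Gw"

definition divide_gf4 :: "gf4 \<Rightarrow> gf4 \<Rightarrow> gf4" where "(a :: gf4) div b = a * inverse b"

instance
proof
  fix a b c :: gf4
  show "a + b + c = a + (b + c)" by (cases a; cases b; cases c) simp_all
  show "a + b = b + a" by (cases a; cases b) simp_all
  show "0 + a = a" by (simp add: zero_gf4_def)
  show "- a + a = 0" by (cases a) (simp_all add: zero_gf4_def uminus_gf4_def)
  show "a - b = a + - b" by (simp add: minus_gf4_def uminus_gf4_def)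
  show "a * b * c = a * (b * c)" by (cases a; cases b; cases c) simp_all
  show "a * b = b * a" by (cases a; cases b) simp_all
  show "1 * a = a" by (cases a) (simp_all add: one_gf4_def)
  show "(a + b) * c = a * c + b * c" by (cases a; cases b; cases c) simp_all
  show "(0 :: gf4) \<noteq> 1" by (simp add: zero_gf4_def one_gf4_def)
  show "inverse a * a = 1" if "a \<noteq> 0"
    using that by (cases a) (simp_all add: zero_gf4_def one_gf4_def)
  show "a div b = a * inverse b" by (simp add: divide_gf4_def)
  show "inverse (0 :: gf4) = 0" by (simp add: zero_gf4_def)
qed

end

abbreviation \<omega> :: gf4 where "\<omega> \<equiv> Gw"

lemma omega_square: "\<omega> ^ 2 = \<omega> + 1"
  by (simp add: power2_eq_square one_gf4_def)

lemma UNIV_gf4: "(UNIV :: gf4 set) = {0, 1, \<omega>, \<omega> ^ 2}"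
  using gf4.exhaust by (auto simp: power2_eq_square zero_gf4_def one_gf4_def)

definition conj4 :: "gf4 \<Rightarrow> gf4" where
  "conj4 x = x ^ 2"

definition trace4 :: "gf4 \<Rightarrow> gf4" where
  "trace4 x = x + conj4 x"

section \<open>Additive codes\<close>

definition hamming_weight :: "gf4 ^ 'n \<Rightarrow> nat" where
  "hamming_weight v = card {i. v $ i \<noteq> 0}"

definition additive_subgroup :: "(gf4 ^ 'n) set \<Rightarrow> bool" where
  "additive_subgroup C \<longleftrightarrow>
     0 \<in> C \<and> (\<forall>u\<in>C. \<forall>v\<in>C. u + v \<in> C) \<and> (\<forall>u\<in>C. - u \<in> C)"

text \<open>\<open>additive_code n k d C\<close> says that \<open>C\<close> is an additive \<open>(n, 2^k, d)\<close> code;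
  the length \<open>n\<close> is the size of the index type.\<close>

definition additive_code :: "nat \<Rightarrow> nat \<Rightarrow> nat \<Rightarrow> (gf4 ^ 'n) set \<Rightarrow> bool" where
  "additive_code n k d C \<longleftrightarrow>
     CARD('n) = n \<and> additive_subgroup C \<and> card C = 2 ^ k \<and>
     (\<exists>c\<in>C - {0}. hamming_weight c = d) \<and> (\<forall>c\<in>C - {0}. d \<le> hamming_weight c)"

definition dual_code :: "(gf4 ^ 'n) set \<Rightarrow> (gf4 ^ 'n) set" where
  "dual_code C = {u. \<forall>c\<in>C. (\<Sum>i\<in>UNIV. trace4 (u $ i * conj4 (c $ i))) = 0}"

definition weight_count :: "(gf4 ^ 'n) set \<Rightarrow> nat \<Rightarrow> nat" where
  "weight_count C i = card {c \<in> C. hamming_weight c = i}"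

text \<open>A polynomial in \<open>x\<close> and \<open>y\<close> is represented as a polynomial in \<open>x\<close> whose coefficients
  are polynomials in \<open>y\<close>: the summand below is \<open>A\<^sub>i x^(n-i) y^i\<close>. Hence
  \<open>poly (weight_enumerator C) 1\<close> is \<open>W(1, y)\<close>.\<close>

definition weight_enumerator :: "(gf4 ^ 'n) set \<Rightarrow> int poly poly" where
  "weight_enumerator C =
     (\<Sum>i\<le>CARD('n). monom (monom (int (weight_count C i)) i) (CARD('n) - i))"

definition formally_self_dual :: "(gf4 ^ 'n) set \<Rightarrow> bool" where
  "formally_self_dual C \<longleftrightarrow> weight_enumerator C = weight_enumerator (dual_code C)"

text \<open>Permutation of the coordinates by \<open>\<pi>\<close>, then multiplication of coordinate \<open>i\<close> by \<open>a i\<close>,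
  then conjugation of the coordinates in \<open>S\<close>.\<close>

definition code_map ::
    "('n \<Rightarrow> 'n) \<Rightarrow> ('n \<Rightarrow> gf4) \<Rightarrow> 'n set \<Rightarrow> gf4 ^ 'n \<Rightarrow> gf4 ^ 'n" where
  "code_map \<pi> a S v =
     (\<chi> i. if i \<in> S then conj4 (a i * v $ \<pi> i) else a i * v $ \<pi> i)"

definition Aut :: "(gf4 ^ 'n) set \<Rightarrow> (gf4 ^ 'n \<Rightarrow> gf4 ^ 'n) set" where
  "Aut C = {f. (\<exists>\<pi> a S. bij \<pi> \<and> (\<forall>i. a i \<noteq> 0) \<and> f = code_map \<pi> a S) \<and> f ` C = C}"

section \<open>The two cyclic codes\<close>

text \<open>The index type \<open>13\<close> is the ring of integers modulo 13, so index arithmetic wraps around.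
  The library function \<open>vector\<close> puts the entries of the list at the indices \<open>1, 2, \<dots>, 13 = 0\<close>.\<close>

definition cyclic_shifts :: "'a ^ 13 \<Rightarrow> ('a ^ 13) set" where
  "cyclic_shifts v = range (\<lambda>j. \<chi> i. v $ (i + j))"

definition C13_1 :: "(gf4 ^ 13) set" where
  "C13_1 = group_closure (cyclic_shifts (vector [\<omega>, 1, 0, 1, 0, 0, 1, 1, 1, 0, 0, 0, 0]))"

definition C13_2 :: "(gf4 ^ 13) set" where
  "C13_2 = group_closure (cyclic_shifts (vector [\<omega>, 1, 1, 1, 0, 1, 1, 1, 1, 1, 0, 1, 0]))"

definition W13 :: "int poly" where
  "W13 = (let y = [:0, 1:] in
     1 + 247 * y ^ 6 + 481 * y ^ 7 + 936 * y ^ 8 + 1625 * y ^ 9 + 2197 * y ^ 10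
       + 1755 * y ^ 11 + 715 * y ^ 12 + 235 * y ^ 13)"

end

theory Submission
  imports Defs
begin

text \<open>If \<open>g $ 0 = \<omega>\<close> and all other entries of \<open>g\<close> lie in \<open>GF(2)\<close>, the dual of the code generated by
  the cyclic shifts of \<open>g\<close> is generated by the shifts of the reflected vector \<open>\<chi> i. g $ (- i)\<close>:
  \<open>trace4\<close> reads off the coefficients of a word in the generators, which reduces the claim to words
  over \<open>GF(2)\<close>. So the code has the weights of its dual, and \<open>2^n\<close> words. The weights of the 8192
  words are found by enumeration.

  An automorphism preserves the number of words of weight 6 that are nonzero at three given
  coordinates, up to its permutation of the coordinates. After a translation the permutation fixes 0
  and preserves the table of these numbers for the triples \<open>{0, x, y}\<close>; a backtracking search leaves
  only the multiplications by 1, respectively by 1, 3, 4, 9, 10, 12. The permutation determines the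
  automorphism, because some word of weight 6 is the only word with its support.\<close>

section \<open>Circulant codes and their duals\<close>

lemma gf4_add_self [simp]: "x + x = 0" for x :: gf4
  by (cases x) (simp_all add: zero_gf4_def)

lemma vec_gf4_minus [simp]: "- v = v" for v :: "gf4 ^ 'n"
  by (simp add: vec_eq_iff uminus_gf4_def)

lemma vec_gf4_diff: "u - v = u + v" for u v :: "gf4 ^ 'n"
  by (simp add: vec_eq_iff minus_gf4_def)

lemma conj4_simps [simp]:
  "conj4 G0 = G0" "conj4 G1 = G1" "conj4 Gw = Gw2" "conj4 Gw2 = Gw"
  by (simp_all add: conj4_def power2_eq_square)

lemma conj4_add: "conj4 (x + y) = conj4 x + conj4 y"
  by (cases x; cases y) (simp_all add: zero_gf4_def)

lemma conj4_eq_0_iff [simp]: "conj4 x = 0 \<longleftrightarrow> x = 0"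
  by (cases x) (simp_all add: zero_gf4_def)

lemma conj4_eq_iff [simp]: "conj4 x = conj4 y \<longleftrightarrow> x = y"
  by (cases x; cases y) (simp_all add: zero_gf4_def)

lemma trace4_simps [simp]:
  "trace4 G0 = G0" "trace4 G1 = G0" "trace4 Gw = G1" "trace4 Gw2 = G1"
  by (simp_all add: trace4_def zero_gf4_def)

lemma trace4_0 [simp]: "trace4 0 = 0"
  by (simp add: zero_gf4_def)

lemma trace4_add: "trace4 (x + y) = trace4 x + trace4 y"
  by (cases x; cases y) (simp_all add: zero_gf4_def)

lemma trace4_sum: "trace4 (sum f B) = (\<Sum>s\<in>B. trace4 (f s))"
  by (induction B rule: infinite_finite_induct) (simp_all add: trace4_add)

section \<open>The trace inner product\<close>

definition trace_inner :: "gf4 ^ 'n \<Rightarrow> gf4 ^ 'n \<Rightarrow> gf4" where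
  "trace_inner u c = (\<Sum>i\<in>UNIV. trace4 (u $ i * conj4 (c $ i)))"

lemma trace_inner_commute: "trace_inner u c = trace_inner c u"
proof -
  have "trace4 (x * conj4 y) = trace4 (y * conj4 x)" for x y
    by (cases x; cases y) simp_all
  then show ?thesis
    unfolding trace_inner_def by (intro sum.cong refl) auto
qed

lemma trace_inner_add_left: "trace_inner (u + v) c = trace_inner u c + trace_inner v c"
  by (simp add: trace_inner_def distrib_right trace4_add sum.distrib)

lemma trace_inner_add_right: "trace_inner c (u + v) = trace_inner c u + trace_inner c v"
  by (metis trace_inner_add_left trace_inner_commute)

lemma trace_inner_0_left [simp]: "trace_inner 0 c = 0"
  by (simp add: trace_inner_def)

lemma trace_inner_0_right [simp]: "trace_inner c 0 = 0"
  by (metis trace_inner_0_left trace_inner_commute)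

text \<open>The trace inner product is additive in its second argument, so orthogonality to the
  generators passes to the whole closure.\<close>

lemma dual_code_group_closure:
  "dual_code (group_closure S) = {u. \<forall>c\<in>S. trace_inner u c = 0}"
proof -
  have "trace_inner u c = 0"
    if "c \<in> group_closure S" and "\<forall>c\<in>S. trace_inner u c = 0" for u c
    using that
    by (induction rule: group_closure.induct) (auto simp: vec_gf4_diff trace_inner_add_right)
  then show ?thesis
    unfolding dual_code_def trace_inner_def [symmetric] by (blast intro: group_closure.base)
qed

text \<open>Lets symmetries be checked on generators alone: shifts, reflection and dilations are all
  additive. With \<open>h = id\<close> it gives monotonicity.\<close>

lemma group_closure_image:
  fixes h :: "'a::ab_group_add \<Rightarrow> 'b::ab_group_add"
  assumes "x \<in> group_closure S" and "\<And>x y. h (x - y) = h x - h y"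
    and "\<And>s. s \<in> S \<Longrightarrow> h s \<in> group_closure T"
  shows "h x \<in> group_closure T"
proof -
  have "h 0 = 0"
    using assms(2) [of 0 0] by simp
  with assms(1) show ?thesis
    by (induction rule: group_closure.induct) (auto simp: assms(2,3) intro: group_closure.diff)
qed

lemma group_closure_sum:
  assumes "\<And>s. s \<in> B \<Longrightarrow> f s \<in> group_closure S"
  shows "sum f B \<in> group_closure S"
  using assms by (induction B rule: infinite_finite_induct) (auto intro: group_closure_add)

section \<open>Shifts, reflection and circulant codes\<close>

definition shift :: "'n::{finite,ab_group_add} \<Rightarrow> ('a, 'n) vec \<Rightarrow> ('a, 'n) vec" where
  "shift s v = (\<chi> i. v $ (i - s))"

definition reflect :: "'a ^ 'n::{finite,ab_group_add} \<Rightarrow> ('a, 'n) vec" where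
  "reflect v = (\<chi> i. v $ (- i))"

definition circ_code :: "'a::ab_group_add ^ 'n::{finite,ab_group_add} \<Rightarrow> ('a, 'n) vec set" where
  "circ_code g = group_closure (range (\<lambda>s. shift s g))"

text \<open>The trace vanishes on GF(2) and is 1 at \<open>\<omega>\<close>, so under this condition
  the entrywise trace of \<open>shift s g\<close> is the indicator of \<open>s\<close>.\<close>

definition circ_gen :: "gf4 ^ 'n::{finite,ab_group_add} \<Rightarrow> bool" where
  "circ_gen g \<longleftrightarrow> g $ 0 = \<omega> \<and> (\<forall>i. i \<noteq> 0 \<longrightarrow> g $ i = G0 \<or> g $ i = G1)"

text \<open>In characteristic 2 the coefficients are 0 or 1, so a set of shifts describes a
  combination of them.\<close>

definition circ_word :: "gf4 ^ 'n::{finite,ab_group_add} \<Rightarrow> 'n set \<Rightarrow> (gf4, 'n) vec" where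
  "circ_word g B = (\<Sum>s\<in>B. shift s g)"

lemma shift_nth [simp]: "shift s v $ i = v $ (i - s)"
  by (simp add: shift_def)

lemma reflect_nth [simp]: "reflect v $ i = v $ (- i)"
  by (simp add: reflect_def)

lemma reflect_reflect [simp]: "reflect (reflect v) = v"
  by (simp add: vec_eq_iff)

lemma shift_shift [simp]: "shift s (shift t v) = shift (s + t) v"
  by (simp add: vec_eq_iff algebra_simps)

lemma shift_0 [simp]: "shift 0 v = v"
  by (simp add: vec_eq_iff)

lemma circ_gen_reflect: "circ_gen g \<Longrightarrow> circ_gen (reflect g)"
  by (simp add: circ_gen_def)

lemma circ_gen_trace4: "circ_gen g \<Longrightarrow> trace4 (g $ i) = (if i = 0 then G1 else G0)"
  by (auto simp: circ_gen_def)

lemma circ_word_in_circ_code: "circ_word g B \<in> circ_code g"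
  unfolding circ_word_def circ_code_def
  by (rule group_closure_sum) (auto intro: group_closure.base)

lemma trace4_circ_word:
  assumes "circ_gen g"
  shows "trace4 (circ_word g B $ i) = (if i \<in> B then G1 else G0)"
proof -
  have "trace4 (circ_word g B $ i) = (\<Sum>s\<in>B. trace4 (g $ (i - s)))"
    by (simp add: circ_word_def trace4_sum)
  also have "\<dots> = (\<Sum>s\<in>B. if i = s then G1 else 0)"
    by (intro sum.cong refl) (simp add: circ_gen_trace4 [OF assms] zero_gf4_def)
  also have "\<dots> = (if i \<in> B then G1 else G0)"
    by (simp flip: zero_gf4_def)
  finally show ?thesis .
qed

text \<open>Outside the coordinates \<open>s\<close> and \<open>t\<close> both factors lie in GF(2),
  where the trace is 0. If \<open>s\<close> and \<open>t\<close> differ, these two coordinates both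
  contribute \<open>g $ (s - t)\<close> and cancel; if they coincide, the product is
  \<open>\<omega> * conj4 \<omega> = 1\<close>, of trace 0.\<close>

lemma trace_inner_shift_reflect:
  assumes "circ_gen g"
  shows "trace_inner (shift s (reflect g)) (shift t g) = 0"
proof -
  let ?h = "\<lambda>i. trace4 (g $ (s - i) * conj4 (g $ (i - t)))"
  have g: "g $ 0 = Gw" "\<And>i. i \<noteq> 0 \<Longrightarrow> g $ i = G0 \<or> g $ i = G1"
    using assms by (auto simp: circ_gen_def)
  have "?h i = 0" if "i \<notin> {s, t}" for i
    using g(2) [of "s - i"] g(2) [of "i - t"] that by (auto simp: zero_gf4_def)
  then have "(\<Sum>i\<in>UNIV. ?h i) = (\<Sum>i\<in>{s, t}. ?h i)"
    by (intro sum.mono_neutral_right) auto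
  also have "\<dots> = 0"
    using g(1) g(2) [of "s - t"] by (cases "s = t") (auto simp: zero_gf4_def)
  finally show ?thesis
    by (simp add: trace_inner_def)
qed

lemma circ_code_subset_dual:
  assumes "circ_gen g"
  shows "circ_code (reflect g) \<subseteq> dual_code (circ_code g)"
proof
  fix u assume "u \<in> circ_code (reflect g)"
  then have "trace_inner u (shift t g) = 0" for t
    unfolding circ_code_def
    by (induction rule: group_closure.induct)
      (auto simp: vec_gf4_diff trace_inner_add_left trace_inner_shift_reflect [OF assms])
  then show "u \<in> dual_code (circ_code g)"
    by (auto simp: circ_code_def dual_code_group_closure)
qed

lemma dual_subset_circ_words:
  assumes g: "circ_gen g"
  shows "dual_code (circ_code g) \<subseteq> range (circ_word (reflect g))"
proof
  fix u assume u: "u \<in> dual_code (circ_code g)"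
  \<comment> \<open>The only combination that can equal \<open>u\<close> is the one with the same
    entrywise trace; the difference \<open>w\<close> then has entries in GF(2).\<close>
  define B where "B = {i. trace4 (u $ i) = G1}"
  define w where "w = u + circ_word (reflect g) B"
  have "circ_word (reflect g) B \<in> dual_code (circ_code g)"
    using circ_word_in_circ_code circ_code_subset_dual [OF g] by blast
  then have orth: "trace_inner w (shift s g) = 0" for s
    using u by (auto simp: w_def circ_code_def dual_code_group_closure trace_inner_add_left)
  have tr: "w $ i = G0 \<or> w $ i = G1" for i
  proof -
    have "trace4 (w $ i) = G0"
      by (cases "u $ i")
        (auto simp: w_def trace4_add trace4_circ_word [OF circ_gen_reflect [OF g]] B_def
          zero_gf4_def)
    then show ?thesis
      by (cases "w $ i") auto
  qed
  have "w $ s = 0" for s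
  proof -
    \<comment> \<open>The shift by \<open>s\<close> leaves GF(2) only at coordinate
      \<open>s\<close>, so pairing with it isolates \<open>w $ s\<close>.\<close>
    have "trace4 (w $ i * conj4 (g $ (i - s))) = 0" if "i \<noteq> s" for i
    proof -
      have "g $ (i - s) = G0 \<or> g $ (i - s) = G1"
        using g that by (simp add: circ_gen_def)
      then show ?thesis
        using tr [of i] by (auto simp: zero_gf4_def)
    qed
    then have "(\<Sum>i\<in>UNIV. trace4 (w $ i * conj4 (shift s g $ i)))
        = (\<Sum>i\<in>{s}. trace4 (w $ i * conj4 (shift s g $ i)))"
      by (intro sum.mono_neutral_right) auto
    then have "trace4 (w $ s * conj4 Gw) = 0"
      using orth [of s] g by (simp add: trace_inner_def circ_gen_def)
    then show ?thesis
      using tr [of s] by (auto simp: zero_gf4_def)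
  qed
  then have "u + circ_word (reflect g) B = 0"
    by (simp add: w_def vec_eq_iff)
  then have "u = circ_word (reflect g) B"
    by (metis eq_neg_iff_add_eq_0 vec_gf4_minus)
  then show "u \<in> range (circ_word (reflect g))"
    by blast
qed

lemma dual_circ_code:
  assumes "circ_gen g"
  shows "dual_code (circ_code g) = circ_code (reflect g)"
  using dual_subset_circ_words [OF assms] circ_code_subset_dual [OF assms] circ_word_in_circ_code
  by blast

text \<open>Duality applied to \<open>reflect g\<close> encloses the code between its subset sums
  and a dual contained in them; traces recover the subset, so the sums are distinct.\<close>

lemma card_circ_code:
  fixes g :: "gf4 ^ 'n::{finite,ab_group_add}"
  assumes "circ_gen g"
  shows "card (circ_code g) = 2 ^ CARD('n)"
proof -
  have "circ_code g = range (circ_word g)"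
    using dual_subset_circ_words [OF circ_gen_reflect [OF assms]]
      circ_code_subset_dual [OF circ_gen_reflect [OF assms]] circ_word_in_circ_code [of g]
    by auto
  moreover have "inj (circ_word g)"
  proof (rule injI)
    fix B B' assume "circ_word g B = circ_word g B'"
    then have "i \<in> B \<longleftrightarrow> i \<in> B'" for i
      by (metis trace4_circ_word [OF assms] gf4.distinct(1))
    then show "B = B'"
      by blast
  qed
  ultimately show ?thesis
    by (simp add: card_image card_Pow flip: Pow_UNIV)
qed

lemma additive_subgroup_circ_code: "additive_subgroup (circ_code g)"
  by (auto simp: additive_subgroup_def circ_code_def intro: group_closure_add)

lemma shift_in_circ_code:
  assumes "c \<in> circ_code g"
  shows "shift t c \<in> circ_code g"
proof -
  have "shift t (x - y) = shift t x - shift t y" for x y :: "('a, 'b) vec"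
    by (simp add: vec_eq_iff)
  with assms show ?thesis
    unfolding circ_code_def
    by (elim group_closure_image) (auto intro!: group_closure.base)
qed

lemma reflect_in_circ_code:
  assumes "c \<in> circ_code g"
  shows "reflect c \<in> circ_code (reflect g)"
proof -
  have "reflect (shift s g) = shift (- s) (reflect g)" for s
    by (simp add: vec_eq_iff)
  moreover have "reflect (x - y) = reflect x - reflect y" for x y :: "('a, 'b) vec"
    by (simp add: vec_eq_iff)
  ultimately show ?thesis
    using assms unfolding circ_code_def
    by (elim group_closure_image) (auto intro!: group_closure.base)
qed

section \<open>Weights and formal self-duality\<close>

lemma hamming_weight_permute:
  assumes "bij \<pi>" and "\<And>i. w $ i = 0 \<longleftrightarrow> v $ \<pi> i = 0"
  shows "hamming_weight w = hamming_weight v"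
proof -
  have "{i. v $ i \<noteq> 0} = \<pi> ` {i. w $ i \<noteq> 0}"
    using assms by (auto simp: image_iff) (metis bij_pointE)
  then show ?thesis
    using assms(1) by (simp add: hamming_weight_def card_image bij_def inj_on_subset [OF _ subset_UNIV])
qed

lemma hamming_weight_reflect: "hamming_weight (reflect v) = hamming_weight v"
  by (rule hamming_weight_permute [OF bij_uminus]) simp

text \<open>Reflection is an involution that preserves weights and carries the code onto its
  dual.\<close>

lemma formally_self_dual_circ_code:
  assumes "circ_gen g"
  shows "formally_self_dual (circ_code g)"
proof -
  have "bij_betw reflect {c \<in> circ_code g. hamming_weight c = i}
      {c \<in> circ_code (reflect g). hamming_weight c = i}" for i
    by (rule bij_betwI [where g = reflect])
      (auto simp: hamming_weight_reflect dest: reflect_in_circ_code)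
  then have "weight_count (circ_code g) i = weight_count (circ_code (reflect g)) i" for i
    unfolding weight_count_def by (rule bij_betw_same_card)
  then show ?thesis
    by (simp add: formally_self_dual_def weight_enumerator_def dual_circ_code [OF assms])
qed

section \<open>Words of length 13 as lists\<close>

definition index13 :: "13 \<Rightarrow> nat" where
  "index13 i = nat (Rep_bit1 i)"

text \<open>The head of the list sits at index 0, whereas \<open>vector\<close> starts at index
  1.\<close>

definition word_of :: "'a list \<Rightarrow> 'a ^ 13" where
  "word_of l = (\<chi> i. l ! index13 i)"

lemma Rep_13_bounds: "0 \<le> Rep_bit1 i" "Rep_bit1 i < 13" for i :: 13
  using type_definition.Rep [OF bit1.type, of i] by simp_all

lemma Rep_13_of_nat: "Rep_bit1 (of_nat k :: 13) = int k mod 13"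
  \<comment> \<open>\<open>num1 bit1 bit0\<close> is the type 6, and 13 = 2 * 6 + 1.\<close>
  using bit1.Rep_Abs_mod [of "int k", where 'a = "num1 bit1 bit0"] by (simp add: bit1.of_nat_eq)

lemma index13_less [simp]: "index13 i < 13"
  using Rep_13_bounds [of i] by (simp add: index13_def)

lemma index13_of_nat [simp]: "index13 (of_nat k) = k mod 13"
  by (simp add: index13_def Rep_13_of_nat nat_mod_distrib)

lemma of_nat_index13 [simp]: "of_nat (index13 i) = i"
proof -
  have "Rep_bit1 (of_nat (index13 i) :: 13) = Rep_bit1 i"
    unfolding Rep_13_of_nat using Rep_13_bounds [of i] by (simp add: index13_def)
  then show ?thesis
    by (simp only: Rep_bit1_inject)
qed

lemma index13_eq_iff [simp]: "index13 i = index13 j \<longleftrightarrow> i = j"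
  by (metis of_nat_index13)

lemma of_nat_13_eq_iff: "of_nat j = (of_nat k :: 13) \<longleftrightarrow> j mod 13 = k mod 13"
  by (metis index13_of_nat index13_eq_iff)

lemma word_of_nth_of_nat: "word_of l $ of_nat k = l ! (k mod 13)"
  by (simp add: word_of_def)

lemma word_of_nth: "word_of l $ i = l ! index13 i"
  by (simp add: word_of_def)

lemma word_of_eq_iff:
  assumes "length u = 13" and "length v = 13"
  shows "word_of u = word_of v \<longleftrightarrow> u = v"
proof
  assume "word_of u = word_of v"
  then have "u ! k = v ! k" if "k < 13" for k
    using that word_of_nth_of_nat [of u k] word_of_nth_of_nat [of v k] by simp
  then show "u = v"
    using assms by (simp add: list_eq_iff_nth_eq)
qed simp

lemma vector_nth:
  assumes "k < length l" and "length l \<le> 13"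
  shows "(vector l :: 'a::zero ^ 13) $ (1 + of_nat k) = l ! k"
proof -
  have "foldr (\<lambda>x f n. fun_upd (f (n + 1)) n x) l (\<lambda>n x. 0) m (m + of_nat k) = l ! k"
    for m :: 13
    using assms
  proof (induction l arbitrary: m k)
    case (Cons a l)
    show ?case
    proof (cases k)
      case (Suc k')
      \<comment> \<open>With at most 13 entries the index does not wrap around, so the update at
        \<open>m\<close> does not overwrite a later entry.\<close>
      have "of_nat k \<noteq> (of_nat 0 :: 13)"
        using Cons.prems Suc by (subst of_nat_13_eq_iff) auto
      then have "m + of_nat k \<noteq> m"
        by simp
      then show ?thesis
        using Cons.IH [of k' "m + 1"] Cons.prems Suc by (simp add: add.assoc)
    qed simp
  qed simp
  then show ?thesis
    by (simp add: vector_def)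
qed

text \<open>The offset between the two indexings turns the cyclic shift by \<open>j\<close> into
  \<open>shift (1 - j)\<close>; as \<open>j\<close> runs through all residues, so does
  \<open>1 - j\<close>.\<close>

lemma cyclic_shifts_vector:
  assumes "length l = 13"
  shows "group_closure (cyclic_shifts (vector l)) = circ_code (word_of (l :: gf4 list))"
proof -
  have vec: "vector l $ (1 + i) = word_of l $ i" for i :: 13
    using vector_nth [of "index13 i" l] assms by (simp add: word_of_nth)
  have "(\<chi> i. vector l $ (i + j)) = shift (1 - j) (word_of l)" for j
    using vec [of "_ + j - 1"] by (simp add: vec_eq_iff algebra_simps)
  moreover have "range (\<lambda>j :: 13. shift (1 - j) (word_of l)) = range (\<lambda>s. shift s (word_of l))"
    by (auto simp: image_iff) (metis diff_diff_eq2 add_diff_cancel_left')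
  ultimately show ?thesis
    by (simp add: cyclic_shifts_def circ_code_def)
qed

section \<open>Enumerating a code\<close>

fun add_words :: "gf4 list \<Rightarrow> gf4 list \<Rightarrow> gf4 list" where
  "add_words (a # u) (b # v) = (a + b) # add_words u v"
| "add_words u v = []"

text \<open>Processes the subset sums as they arise, so that evaluation need not build the list
  \<open>span_list\<close>, which serves as the specification.\<close>

primrec fold_span ::
    "(gf4 list \<Rightarrow> 'a \<Rightarrow> 'a) \<Rightarrow> gf4 list list \<Rightarrow> gf4 list \<Rightarrow> 'a \<Rightarrow> 'a" where
  "fold_span f [] c a = f c a"
| "fold_span f (r # rs) c a = fold_span f rs (add_words r c) (fold_span f rs c a)"

primrec span_list :: "gf4 list list \<Rightarrow> gf4 list \<Rightarrow> gf4 list list" where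
  "span_list [] c = [c]"
| "span_list (r # rs) c = span_list rs c @ span_list rs (add_words r c)"

definition rotations :: "'a list \<Rightarrow> 'a list list" where
  "rotations p = map (\<lambda>m. rotate m p) [0..<length p]"

definition fold_code :: "(gf4 list \<Rightarrow> 'a \<Rightarrow> 'a) \<Rightarrow> gf4 list \<Rightarrow> 'a \<Rightarrow> 'a" where
  "fold_code f p = fold_span f (rotations p) (replicate (length p) G0)"

definition code_list :: "gf4 list \<Rightarrow> gf4 list list" where
  "code_list p = span_list (rotations p) (replicate (length p) G0)"

definition keep :: "('x \<Rightarrow> gf4 list \<Rightarrow> bool) \<Rightarrow> 'x \<Rightarrow> gf4 list \<Rightarrow> gf4 list list \<Rightarrow> gf4 list list" where
  "keep P x c cs = (if P x c then c # cs else cs)"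

text \<open>The predicate takes its parameter \<open>x\<close> separately so that it can be a constant: with an
  abstraction in its place the simplifier would normalize the accumulator again at every word.\<close>

definition collect :: "('x \<Rightarrow> gf4 list \<Rightarrow> bool) \<Rightarrow> 'x \<Rightarrow> gf4 list \<Rightarrow> gf4 list list" where
  "collect P x p = fold_code (keep P x) p []"

lemma fold_span_eq_fold: "fold_span f rs c a = fold f (span_list rs c) a"
  by (induction rs arbitrary: c a) simp_all

lemma fold_code_eq_fold: "fold_code f p = fold f (code_list p)"
  by (simp add: fun_eq_iff fold_code_def code_list_def fold_span_eq_fold)

lemma collect_eq_filter: "collect P x p = rev (filter (P x) (code_list p))"
proof -
  have "fold (keep P x) l a = rev (filter (P x) l) @ a" for l a
    by (induction l arbitrary: a) (auto simp: keep_def)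
  then show ?thesis
    by (simp add: collect_def fold_code_eq_fold)
qed

lemma length_add_words [simp]: "length (add_words u v) = min (length u) (length v)"
  by (induction u v rule: add_words.induct) simp_all

lemma nth_add_words:
  "k < length u \<Longrightarrow> k < length v \<Longrightarrow> add_words u v ! k = u ! k + v ! k"
  by (induction u v arbitrary: k rule: add_words.induct) (auto simp: nth_Cons split: nat.split)

lemma word_of_add_words:
  "length u = 13 \<Longrightarrow> length v = 13 \<Longrightarrow> word_of (add_words u v) = word_of u + word_of v"
  by (simp add: vec_eq_iff word_of_nth nth_add_words)

lemma word_of_zero: "word_of (replicate 13 G0) = 0"
  by (simp add: vec_eq_iff word_of_nth zero_gf4_def)

lemma length_span_list: "length (span_list rs c) = 2 ^ length rs"
  by (induction rs arbitrary: c) simp_all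

lemma length_in_span_list:
  "\<forall>r\<in>set rs. length r = n \<Longrightarrow> length c = n \<Longrightarrow> w \<in> set (span_list rs c) \<Longrightarrow> length w = n"
proof (induction rs arbitrary: c)
  case (Cons r rs)
  then show ?case
    using Cons.IH [of c] Cons.IH [of "add_words r c"] by auto
qed simp

text \<open>Because \<open>a + a = 0\<close>, the new generator occurs with coefficient 0 or 1
  only.\<close>

lemma group_closure_insert_gf4:
  fixes a :: "gf4 ^ 'n"
  shows "group_closure (insert a S) = group_closure S \<union> (+) a ` group_closure S"
proof
  have mono: "x \<in> group_closure (insert a S)" if "x \<in> group_closure S" for x
    using that group_closure_image [of x S id "insert a S"] by (simp add: group_closure.base)
  then show "group_closure S \<union> (+) a ` group_closure S \<subseteq> group_closure (insert a S)"
    by (auto intro!: group_closure_add intro: group_closure.base)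
  have two: "a + (a + x) = x" for x
    using add_minus_cancel [of a x] by simp
  show "group_closure (insert a S) \<subseteq> group_closure S \<union> (+) a ` group_closure S"
  proof
    fix x assume "x \<in> group_closure (insert a S)"
    then show "x \<in> group_closure S \<union> (+) a ` group_closure S"
    proof (induction rule: group_closure.induct)
      case (base s)
      then show ?case
        by (force intro: group_closure.base)
    next
      case (diff s t)
      then obtain s' t' where st: "s' \<in> group_closure S" "t' \<in> group_closure S"
          "s = s' \<or> s = a + s'" "t = t' \<or> t = a + t'"
        by blast
      then have "s - t = s' + t' \<or> s - t = a + (s' + t')"
        by (elim disjE) (simp_all add: vec_gf4_diff add_ac two)
      then show ?case
        using group_closure_add [OF st(1,2)] by auto
    qed
  qed
qed

text \<open>The start word makes the claim one about cosets: each generator splits a coset into two,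
  one for each branch of the recursion.\<close>

lemma span_list_eq_group_closure:
  "\<forall>r\<in>set rs. length r = 13 \<Longrightarrow> length c = 13 \<Longrightarrow>
    word_of ` set (span_list rs c) = (+) (word_of c) ` group_closure (word_of ` set rs)"
proof (induction rs arbitrary: c)
  case (Cons r rs)
  have "word_of ` set (span_list (r # rs) c) = (+) (word_of c) ` group_closure (word_of ` set rs)
      \<union> (+) (word_of (add_words r c)) ` group_closure (word_of ` set rs)"
    using Cons by (simp add: image_Un)
  also have "\<dots> = (+) (word_of c) ` group_closure (word_of ` set (r # rs))"
    using Cons.prems
    by (simp add: group_closure_insert_gf4 image_Un image_image word_of_add_words add_ac)
  finally show ?case .
qed simp

context
  fixes p :: "gf4 list"
  assumes p: "length p = 13"
begin

text \<open>\<open>rotate\<close> moves entries to the left, hence the minus sign in the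
  shift.\<close>

lemma word_of_rotations: "word_of ` set (rotations p) = range (\<lambda>s. shift s (word_of p))"
proof -
  have "word_of (rotate m p) = shift (- of_nat m) (word_of p)" for m
  proof -
    have "rotate m p ! index13 i = p ! index13 (i + of_nat m)" for i
      using index13_of_nat [of "index13 i + m"] p by (simp add: nth_rotate add.commute)
    then show ?thesis
      by (simp add: vec_eq_iff word_of_nth)
  qed
  moreover have "range (\<lambda>s. shift s (word_of p)) = (\<lambda>m. shift (- of_nat m) (word_of p)) ` {..<13}"
    by (auto simp: image_iff) (metis index13_less lessThan_iff minus_minus of_nat_index13)
  ultimately show ?thesis
    using p by (simp add: rotations_def image_image atLeast0LessThan)
qed

lemma length_code_list: "w \<in> set (code_list p) \<Longrightarrow> length w = 13"
  unfolding code_list_def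
  by (erule length_in_span_list [rotated -1]) (auto simp: rotations_def p)

lemma circ_code_eq_code_list: "circ_code (word_of p) = word_of ` set (code_list p)"
proof -
  have "word_of ` set (code_list p) = group_closure (word_of ` set (rotations p))"
    unfolding code_list_def
    by (subst span_list_eq_group_closure) (auto simp: rotations_def p word_of_zero)
  then show ?thesis
    by (simp add: circ_code_def word_of_rotations)
qed

text \<open>The list has \<open>2 ^ 13\<close> entries, as many as the code has words, so no word
  repeats and counting in the list counts in the code.\<close>

lemma distinct_code_list:
  assumes "circ_gen (word_of p)"
  shows "distinct (code_list p)"
proof (rule card_distinct)
  have "card (set (code_list p)) = card (circ_code (word_of p))"
    unfolding circ_code_eq_code_list
    by (intro card_image [symmetric] inj_onI) (simp add: word_of_eq_iff length_code_list)
  also have "\<dots> = 2 ^ 13"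
    by (simp add: card_circ_code [OF assms])
  finally show "card (set (code_list p)) = length (code_list p)"
    by (simp add: code_list_def length_span_list rotations_def p)
qed

lemma card_circ_code_filter:
  assumes "circ_gen (word_of p)" and "\<And>l. length l = 13 \<Longrightarrow> P (word_of l) = Q l"
  shows "card {c \<in> circ_code (word_of p). P c} = length (filter Q (code_list p))"
proof -
  have "{c \<in> circ_code (word_of p). P c} = word_of ` set (filter Q (code_list p))"
    using assms(2) length_code_list by (auto simp: circ_code_eq_code_list)
  also have "card \<dots> = card (set (filter Q (code_list p)))"
    by (intro card_image inj_onI) (simp add: word_of_eq_iff length_code_list)
  finally show ?thesis
    using distinct_code_list [OF assms(1)] by (simp add: distinct_card del: set_filter)
qed

end

section \<open>Weight distribution\<close>

primrec list_weight :: "gf4 list \<Rightarrow> nat" where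
  "list_weight [] = 0"
| "list_weight (x # c) = (if x = G0 then list_weight c else Suc (list_weight c))"

lemma list_weight_eq: "list_weight c = length (filter (\<lambda>x. x \<noteq> G0) c)"
  by (induction c) auto

text \<open>One pass through the word advances along the histogram at each nonzero entry, so the
  cell reached at its end is the one indexed by its weight.\<close>

fun tally :: "gf4 list \<Rightarrow> int list \<Rightarrow> int list" where
  "tally (G0 # c) as = tally c as"
| "tally (x # c) (a # as) = a # tally c as"
| "tally [] (a # as) = (a + 1) # as"
| "tally c [] = []"

lemma hamming_weight_word_of:
  assumes "length l = 13"
  shows "hamming_weight (word_of l) = list_weight l"
proof -
  have "bij_betw index13 {i. word_of l $ i \<noteq> 0} {k. k < length l \<and> l ! k \<noteq> G0}"
    by (rule bij_betwI [where g = of_nat]) (auto simp: word_of_nth zero_gf4_def assms)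
  then show ?thesis
    by (simp add: hamming_weight_def list_weight_eq length_filter_conv_card bij_betw_same_card)
qed

lemma length_tally [simp]: "length (tally c as) = length as"
  by (induction c as rule: tally.induct) simp_all

lemma nth_tally:
  "length c < length as \<Longrightarrow>
    tally c as ! i = (if i = list_weight c then as ! i + 1 else as ! i)"
proof (induction c as arbitrary: i rule: tally.induct)
qed (auto simp: nth_Cons split: nat.splits)

lemma nth_fold_tally:
  "\<forall>c\<in>set cs. length c < length as \<Longrightarrow>
    fold tally cs as ! i = as ! i + int (length (filter (\<lambda>c. list_weight c = i) cs))"
  by (induction cs arbitrary: as) (auto simp: nth_tally)

lemma weight_count_circ_code:
  assumes "length p = 13" and "circ_gen (word_of p)" and "i \<le> 13"
  shows "int (weight_count (circ_code (word_of p)) i) = fold_code tally p (replicate 14 0) ! i"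
proof -
  have "weight_count (circ_code (word_of p)) i
      = length (filter (\<lambda>c. list_weight c = i) (code_list p))"
    unfolding weight_count_def
    by (rule card_circ_code_filter) (simp_all add: assms hamming_weight_word_of)
  then show ?thesis
    using assms length_code_list [of p] by (simp add: fold_code_eq_fold nth_fold_tally)
qed

definition W13_coeffs :: "int list" where
  "W13_coeffs = [1, 0, 0, 0, 0, 0, 247, 481, 936, 1625, 2197, 1755, 715, 235]"

text \<open>Collects what is verified by evaluation; everything except the automorphism count
  follows from it for both codes.\<close>

definition good_generator :: "gf4 list \<Rightarrow> bool" where
  "good_generator p \<longleftrightarrow> length p = 13 \<and> p ! 0 = Gw \<and> list_all (\<lambda>x. x = G0 \<or> x = G1) (tl p)
    \<and> fold_code tally p (replicate 14 0) = W13_coeffs"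

lemma poly_weight_enumerator_1:
  "poly (weight_enumerator (C :: (gf4 ^ 'n) set)) 1
    = (\<Sum>i\<le>CARD('n). monom (int (weight_count C i)) i)"
  by (simp add: weight_enumerator_def poly_sum poly_monom)

lemma W13_eq: "W13 = (\<Sum>i\<le>13. monom (W13_coeffs ! i) i)"
proof -
  have "monom a n = [:a:] * [:0, 1:] ^ n" for a :: int and n
    by (simp add: monom_altdef)
  moreover have "(\<Sum>i\<le>13. f i) = f 0 + f 1 + f 2 + f 3 + f 4 + f 5 + f 6 + f 7 + f 8 + f 9
      + f 10 + f 11 + f 12 + f 13" for f :: "nat \<Rightarrow> int poly"
    by (simp add: eval_nat_numeral)
  ultimately show ?thesis
    unfolding W13_def Let_def by (simp add: W13_coeffs_def numeral_poly one_pCons)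
qed

section \<open>Parameters and weight enumerator from the evaluated histogram\<close>

context
  fixes p :: "gf4 list"
  assumes good: "good_generator p"
begin

lemma good_length: "length p = 13"
  using good by (simp add: good_generator_def)

lemma good_circ_gen: "circ_gen (word_of p)"
proof -
  have "p ! k = G0 \<or> p ! k = G1" if "0 < k" "k < 13" for k
    using good that
    by (auto simp: good_generator_def list_all_length nth_tl dest: spec [where x = "k - 1"])
  moreover have "index13 0 = 0"
    using index13_of_nat [of 0] by simp
  moreover from this have "0 < index13 i" if "i \<noteq> 0" for i
    using that by (metis index13_eq_iff neq0_conv)
  ultimately show ?thesis
    using good by (simp add: circ_gen_def word_of_nth good_generator_def)
qed

lemma good_weight_count:
  "i \<le> 13 \<Longrightarrow> int (weight_count (circ_code (word_of p)) i) = W13_coeffs ! i"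
  using weight_count_circ_code [OF good_length good_circ_gen] good by (simp add: good_generator_def)

lemma good_weight_enumerator: "poly (weight_enumerator (circ_code (word_of p))) 1 = W13"
  by (simp add: poly_weight_enumerator_1 W13_eq good_weight_count)

text \<open>The minimum weight is read off the counts: those at 1 to 5 vanish and the one at 6 does
  not, while only the zero word has weight 0.\<close>

lemma good_additive_code: "additive_code 13 13 6 (circ_code (word_of p))"
proof -
  let ?C = "circ_code (word_of p)"
  have "weight_count ?C 6 \<noteq> 0"
    using good_weight_count [of 6] by (auto simp: W13_coeffs_def)
  then have "{c \<in> ?C. hamming_weight c = 6} \<noteq> {}"
    unfolding weight_count_def by (metis card.empty)
  then have ex: "\<exists>c\<in>?C - {0}. hamming_weight c = 6"
    by (force simp: hamming_weight_def)
  have "6 \<le> hamming_weight c" if "c \<in> ?C - {0}" for c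
  proof (rule ccontr)
    assume "\<not> 6 \<le> hamming_weight c"
    then have i: "hamming_weight c \<in> {0, 1, 2, 3, 4, 5}"
      by auto
    have "weight_count ?C (hamming_weight c) \<noteq> 0"
      using that by (auto simp: weight_count_def)
    moreover have "hamming_weight c \<noteq> 0"
      using that by (auto simp: hamming_weight_def vec_eq_iff)
    ultimately show False
      using i good_weight_count [of "hamming_weight c"] by (auto simp: W13_coeffs_def)
  qed
  with ex show ?thesis
    by (simp add: additive_code_def additive_subgroup_circ_code card_circ_code good_circ_gen)
qed

end

definition gen1 :: "gf4 list" where
  "gen1 = [\<omega>, G1, G0, G1, G0, G0, G1, G1, G1, G0, G0, G0, G0]"

definition gen2 :: "gf4 list" where
  "gen2 = [\<omega>, G1, G1, G1, G0, G1, G1, G1, G1, G1, G0, G1, G0]"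

lemma C13_1_eq: "C13_1 = circ_code (word_of gen1)"
  unfolding C13_1_def by (subst cyclic_shifts_vector) (simp_all add: gen1_def zero_gf4_def one_gf4_def)

lemma C13_2_eq: "C13_2 = circ_code (word_of gen2)"
  unfolding C13_2_def by (subst cyclic_shifts_vector) (simp_all add: gen2_def zero_gf4_def one_gf4_def)

lemma good_gen1: "good_generator gen1"
  by code_simp

lemma good_gen2: "good_generator gen2"
  by code_simp

section \<open>Automorphisms\<close>

lemma code_map_nth:
  "code_map \<pi> a S v $ i = (if i \<in> S then conj4 (a i * v $ \<pi> i) else a i * v $ \<pi> i)"
  by (simp add: code_map_def)

lemma code_map_nth_eq_0_iff:
  "\<forall>i. a i \<noteq> 0 \<Longrightarrow> code_map \<pi> a S v $ i = 0 \<longleftrightarrow> v $ \<pi> i = 0"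
  by (simp add: code_map_nth)

lemma inj_code_map:
  assumes "bij \<pi>" and "\<forall>i. a i \<noteq> 0"
  shows "inj (code_map \<pi> a S)"
proof (rule injI)
  fix u v assume eq: "code_map \<pi> a S u = code_map \<pi> a S v"
  have "u $ \<pi> i = v $ \<pi> i" for i
    using arg_cong [OF eq, of "\<lambda>w. w $ i"] assms(2) by (simp add: code_map_nth split: if_splits)
  then show "u = v"
    using assms(1) by (metis vec_eq_iff bij_pointE)
qed

lemma hamming_weight_code_map:
  assumes "bij \<pi>" and "\<forall>i. a i \<noteq> 0"
  shows "hamming_weight (code_map \<pi> a S v) = hamming_weight v"
  using assms by (intro hamming_weight_permute) (simp_all add: code_map_nth_eq_0_iff)

section \<open>Support counts and the permutation of an automorphism\<close>

definition support_count :: "(gf4 ^ 'n) set \<Rightarrow> nat \<Rightarrow> 'n set \<Rightarrow> nat" where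
  "support_count C w X = card {c \<in> C. hamming_weight c = w \<and> (\<forall>x\<in>X. c $ x \<noteq> 0)}"

text \<open>Keeps visible the permutation that \<open>Aut\<close> hides behind a quantifier.\<close>

definition automorphism_over ::
    "(gf4 ^ 'n) set \<Rightarrow> ('n \<Rightarrow> 'n) \<Rightarrow> (gf4 ^ 'n \<Rightarrow> gf4 ^ 'n) \<Rightarrow> bool" where
  "automorphism_over C \<pi> f \<longleftrightarrow>
    bij \<pi> \<and> f ` C = C \<and> (\<exists>a S. (\<forall>i. a i \<noteq> 0) \<and> f = code_map \<pi> a S)"

lemma automorphism_overI:
  "bij \<pi> \<Longrightarrow> \<forall>i. a i \<noteq> 0 \<Longrightarrow> code_map \<pi> a S ` C = C \<Longrightarrow> automorphism_over C \<pi> (code_map \<pi> a S)"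
  by (auto simp: automorphism_over_def)

lemma automorphism_overE:
  assumes "automorphism_over C \<pi> f"
  obtains a S where "bij \<pi>" "\<forall>i. a i \<noteq> 0" "f = code_map \<pi> a S" "f ` C = C"
  using assms by (auto simp: automorphism_over_def)

lemma Aut_eq_automorphism_over: "Aut C = {f. \<exists>\<pi>. automorphism_over C \<pi> f}"
  by (auto simp: Aut_def automorphism_over_def)

text \<open>Nonzero multipliers and conjugation preserve zeros, so \<open>f\<close> maps the words
  nonzero on the image of \<open>X\<close> bijectively to those nonzero on \<open>X\<close>.\<close>

lemma support_count_permute:
  assumes "automorphism_over C \<pi> f"
  shows "support_count C w (\<pi> ` X) = support_count C w X"
proof -
  obtain a S where \<pi>: "bij \<pi>" and a: "\<forall>i. a i \<noteq> 0" and f: "f = code_map \<pi> a S" and C: "f ` C = C"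
    using assms by (rule automorphism_overE)
  have *: "hamming_weight (f c) = w \<and> (\<forall>x\<in>X. f c $ x \<noteq> 0)
      \<longleftrightarrow> hamming_weight c = w \<and> (\<forall>x\<in>\<pi> ` X. c $ x \<noteq> 0)" for c
    by (simp add: f hamming_weight_code_map [OF \<pi> a] code_map_nth_eq_0_iff [OF a])
  have "{c \<in> C. hamming_weight c = w \<and> (\<forall>x\<in>X. c $ x \<noteq> 0)}
      = f ` {c \<in> C. hamming_weight c = w \<and> (\<forall>x\<in>\<pi> ` X. c $ x \<noteq> 0)}" (is "?A = f ` ?B")
  proof
    show "?A \<subseteq> f ` ?B"
    proof
      fix d assume d: "d \<in> ?A"
      then obtain c where "c \<in> C" "d = f c"
        using C by blast
      with d * [of c] show "d \<in> f ` ?B"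
        by blast
    qed
    show "f ` ?B \<subseteq> ?A"
      using C * by blast
  qed
  moreover have "card (f ` ?B) = card ?B"
    unfolding f by (intro card_image inj_on_subset [OF inj_code_map [OF \<pi> a]]) simp
  ultimately show ?thesis
    by (simp add: support_count_def)
qed

lemma shift_image_circ_code: "shift s ` circ_code g = circ_code g"
proof
  show "circ_code g \<subseteq> shift s ` circ_code g"
  proof
    fix c assume "c \<in> circ_code g"
    then have "c = shift s (shift (- s) c)" "shift (- s) c \<in> circ_code g"
      by (simp_all add: shift_in_circ_code)
    then show "c \<in> shift s ` circ_code g"
      by blast
  qed
qed (auto simp: shift_in_circ_code)

lemma bij_translation: "bij (\<lambda>i. i + s :: 'a::ab_group_add)"
  by (rule bijI') (auto simp: algebra_simps intro: exI [where x = "_ - s"])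

text \<open>Translations are the permutations of the automorphisms given by shifts.\<close>

lemma support_count_translate:
  "support_count (circ_code g) w ((\<lambda>i. i + s) ` X) = support_count (circ_code g) w X"
proof (rule support_count_permute)
  have "code_map (\<lambda>i. i + s) (\<lambda>_. 1) {} = shift (- s)"
    by (simp add: fun_eq_iff vec_eq_iff code_map_nth)
  then show "automorphism_over (circ_code g) (\<lambda>i. i + s) (code_map (\<lambda>i. i + s) (\<lambda>_. 1) {})"
    by (intro automorphism_overI) (simp_all add: bij_translation shift_image_circ_code)
qed

lemma automorphism_over_permutation_unique:
  fixes C :: "(gf4 ^ 'n) set"
  assumes "automorphism_over C \<pi> f" and "automorphism_over C \<pi>' f"
  shows "\<pi> = \<pi>'"
proof
  fix i
  obtain a S where a: "\<forall>i. a i \<noteq> 0" "f = code_map \<pi> a S"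
    using assms(1) by (rule automorphism_overE)
  obtain a' S' where a': "\<forall>i. a' i \<noteq> 0" "f = code_map \<pi>' a' S'"
    using assms(2) by (rule automorphism_overE)
  \<comment> \<open>Only the coordinate that reads position \<open>\<pi> i\<close> is nonzero in the
    image of this unit vector.\<close>
  let ?e = "(\<chi> j. if j = \<pi> i then 1 else 0) :: gf4 ^ 'n"
  have "f ?e $ i \<noteq> 0"
    unfolding a(2) using a(1) by (simp add: code_map_nth_eq_0_iff)
  then show "\<pi> i = \<pi>' i"
    unfolding a'(2) using a'(1) by (simp add: code_map_nth_eq_0_iff split: if_splits)
qed

text \<open>Two automorphisms with the same permutation agree on every word that is alone on its
  support; on one coordinate, they then agree at two different nonzero values, hence everywhere.\<close>

lemma automorphism_determined_by_permutation:
  fixes C :: "(gf4 ^ 'n::{finite,ab_group_add}) set"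
  assumes C: "\<And>v t. v \<in> C \<Longrightarrow> shift t v \<in> C"
    and c: "c \<in> C" "\<And>d. d \<in> C \<Longrightarrow> (\<And>i. d $ i = 0 \<longleftrightarrow> c $ i = 0) \<Longrightarrow> d = c"
    and jk: "c $ j \<noteq> 0" "c $ k \<noteq> 0" "c $ j \<noteq> c $ k"
    and "automorphism_over C \<pi> f" "automorphism_over C \<pi> g"
  shows "f = g"
proof -
  obtain a S where f: "\<forall>i. a i \<noteq> 0" "f = code_map \<pi> a S" "f ` C = C" and "bij \<pi>"
    using \<open>automorphism_over C \<pi> f\<close> by (rule automorphism_overE)
  obtain b R where g: "\<forall>i. b i \<noteq> 0" "g = code_map \<pi> b R" "g ` C = C"
    using \<open>automorphism_over C \<pi> g\<close> by (rule automorphism_overE)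
  have agree: "f (shift t c) = g (shift t c)" for t
  proof -
    have "f (shift t c) \<in> C"
      using f(3) C [OF c(1)] by blast
    \<comment> \<open>The preimage \<open>d\<close> under \<open>g\<close> has the support of
      \<open>shift t c\<close>; shifted back, it has the support of \<open>c\<close> and hence
      equals \<open>c\<close>.\<close>
    then obtain d where d: "d \<in> C" "g d = f (shift t c)"
      using g(3) by (metis imageE)
    have "d $ \<pi> i = 0 \<longleftrightarrow> c $ (\<pi> i - t) = 0" for i
      using arg_cong [OF d(2), of "\<lambda>w. w $ i = 0"] f(1) g(1)
      by (simp add: f(2) g(2) code_map_nth_eq_0_iff)
    then have "d $ i = 0 \<longleftrightarrow> c $ (i - t) = 0" for i
      using \<open>bij \<pi>\<close> by (metis bij_pointE)
    then have "shift (- t) d = c"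
      using C [OF d(1)] by (intro c(2)) simp_all
    then have "d = shift t c"
      by (metis shift_shift shift_0 add.right_inverse)
    then show ?thesis
      using d(2) by simp
  qed
  define L where "L T e i x = (if i \<in> T then conj4 (e i * x) else e i * x)"
    for T :: "'n set" and e i x
  have nth: "code_map \<pi> e T v $ i = L T e i (v $ \<pi> i)" for e T v i
    by (simp add: code_map_nth L_def)
  have add: "L T e i (x + y) = L T e i x + L T e i y" for T e i x y
    by (simp add: L_def distrib_left conj4_add)
  have "L S a i x = L R b i x" for i x
  proof -
    have "L S a i (c $ (\<pi> i - t)) = L R b i (c $ (\<pi> i - t))" for t
      using arg_cong [OF agree [of t], of "\<lambda>w. w $ i"] by (simp add: f(2) g(2) nth)
    \<comment> \<open>These two shifts place the entries \<open>c $ j\<close> and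
      \<open>c $ k\<close> at coordinate \<open>\<pi> i\<close>.\<close>
    from this [of "\<pi> i - j"] this [of "\<pi> i - k"]
    have eqs: "L S a i (c $ j) = L R b i (c $ j)" "L S a i (c $ k) = L R b i (c $ k)"
      by simp_all
    \<comment> \<open>Two distinct nonzero elements span GF(4) additively.\<close>
    have "x = 0 \<or> x = c $ j \<or> x = c $ k \<or> x = c $ j + c $ k"
      using jk by (cases x; cases "c $ j"; cases "c $ k") (simp_all add: zero_gf4_def)
    then show ?thesis
      using eqs by (elim disjE) (simp_all add: add, simp add: L_def)
  qed
  then show ?thesis
    by (simp add: f(2) g(2) fun_eq_iff vec_eq_iff nth)
qed

section \<open>Backtracking search for permutations preserving a table\<close>

text \<open>These functions are first-order, because rewriting normalizes the bodies of abstractions,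
  and with them any captured table, again after every application.\<close>

fun agrees :: "int list list \<Rightarrow> nat \<Rightarrow> nat list \<Rightarrow> int list \<Rightarrow> bool" where
  "agrees M v (u # q) (t # ts) = (if M ! u ! v = t then agrees M v q ts else False)"
| "agrees M v q ts = True"

fun extensions :: "int list list \<Rightarrow> int list \<Rightarrow> nat list \<Rightarrow> nat list \<Rightarrow> nat list list" where
  "extensions M ts q [] = []"
| "extensions M ts q (v # vs) = (if agrees M v (q @ [v]) ts
    then (q @ [v]) # extensions M ts q vs else extensions M ts q vs)"

fun extend_all :: "int list list \<Rightarrow> int list \<Rightarrow> nat list list \<Rightarrow> nat list list" where
  "extend_all M ts [] = []"
| "extend_all M ts (q # qs) = extensions M ts q [0..<length M] @ extend_all M ts qs"

fun column :: "int list list \<Rightarrow> nat \<Rightarrow> int list" where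
  "column [] k = []"
| "column (r # M) k = r ! k # column M k"

fun search :: "int list list \<Rightarrow> nat \<Rightarrow> nat list list" where
  "search M 0 = [[]]"
| "search M (Suc n) = extend_all M (column M n) (search M n)"

lemma agrees_iff:
  "agrees M v q ts \<longleftrightarrow> (\<forall>i<min (length q) (length ts). M ! (q ! i) ! v = ts ! i)"
proof (induction M v q ts rule: agrees.induct)
  case (1 M v u q t ts)
  then show ?case
    by (auto simp: less_Suc_eq_0_disj)
qed simp_all

lemma set_extensions: "set (extensions M ts q vs) = {q @ [v] |v. v \<in> set vs \<and> agrees M v (q @ [v]) ts}"
  by (induction vs) auto

lemma set_extend_all:
  "set (extend_all M ts qs) = (\<Union>q\<in>set qs. set (extensions M ts q [0..<length M]))"
  by (induction qs) auto

lemma length_column [simp]: "length (column M k) = length M"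
  by (induction M) simp_all

lemma nth_column [simp]: "i < length M \<Longrightarrow> column M k ! i = M ! i ! k"
  by (induction M arbitrary: i) (auto simp: less_Suc_eq_0_disj)

text \<open>Each prefix of \<open>\<pi>\<close> survives, since extending it only tests equalities
  that \<open>\<pi>\<close> satisfies. \<open>agrees\<close> stops at the shorter list, so of
  \<open>column M n\<close> just the entries up to the diagonal are compared.\<close>

lemma search_complete:
  "n \<le> length M \<Longrightarrow> \<forall>i<n. \<pi> i < length M \<Longrightarrow> \<forall>i<n. \<forall>j<n. M ! \<pi> i ! \<pi> j = M ! i ! j \<Longrightarrow>
    map \<pi> [0..<n] \<in> set (search M n)"
proof (induction n)
  case (Suc n)
  have "(map \<pi> [0..<n] @ [\<pi> n]) ! i = \<pi> i" if "i < Suc n" for i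
    using that by (auto simp: nth_append less_Suc_eq)
  then have "agrees M (\<pi> n) (map \<pi> [0..<n] @ [\<pi> n]) (column M n)"
    using Suc.prems by (simp add: agrees_iff)
  then have "map \<pi> [0..<n] @ [\<pi> n] \<in> set (extensions M (column M n) (map \<pi> [0..<n]) [0..<length M])"
    using Suc.prems by (simp add: set_extensions)
  then show ?case
    using Suc by (auto simp: set_extend_all)
qed simp

section \<open>The table of triple counts\<close>

fun add_row :: "gf4 list \<Rightarrow> int list \<Rightarrow> int list" where
  "add_row (x # c) (n # ns) = (if x = G0 then n else n + 1) # add_row c ns"
| "add_row c ns = ns"

text \<open>Called with \<open>d = c\<close>, this adds the outer product of the support indicator
  of \<open>c\<close> with itself; \<open>d\<close> stays whole while \<open>c\<close> is
  consumed.\<close>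

fun add_pairs :: "gf4 list \<Rightarrow> gf4 list \<Rightarrow> int list list \<Rightarrow> int list list" where
  "add_pairs d (x # c) (r # rs) = (if x = G0 then r else add_row d r) # add_pairs d c rs"
| "add_pairs d c rs = rs"

text \<open>The test at position 0 supplies the third point of the triple.\<close>

definition count_pairs :: "nat \<Rightarrow> gf4 list \<Rightarrow> int list list \<Rightarrow> int list list" where
  "count_pairs w c M = (if c ! 0 = G0 then M else if list_weight c = w then add_pairs c c M else M)"

definition pair_table :: "nat \<Rightarrow> gf4 list \<Rightarrow> int list list" where
  "pair_table w p = fold_code (count_pairs w) p (replicate 13 (replicate 13 0))"

lemma length_add_row [simp]: "length (add_row c r) = length r"
  by (induction c r rule: add_row.induct) simp_all

lemma nth_add_row:
  "k < length c \<Longrightarrow> k < length r \<Longrightarrow> add_row c r ! k = r ! k + (if c ! k = G0 then 0 else 1)"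
  by (induction c r arbitrary: k rule: add_row.induct) (auto simp: less_Suc_eq_0_disj)

lemma length_add_pairs [simp]: "length (add_pairs d c M) = length M"
  by (induction d c M rule: add_pairs.induct) simp_all

lemma nth_add_pairs:
  "j < length c \<Longrightarrow> j < length M \<Longrightarrow> add_pairs d c M ! j = (if c ! j = G0 then M ! j else add_row d (M ! j))"
  by (induction d c M arbitrary: j rule: add_pairs.induct) (auto simp: less_Suc_eq_0_disj)

lemma nth_fold_count_pairs:
  assumes "j < n" "k < n"
  shows "\<forall>c\<in>set cs. length c = n \<Longrightarrow> length M = n \<Longrightarrow> \<forall>r\<in>set M. length r = n \<Longrightarrow>
    fold (count_pairs w) cs M ! j ! k = M ! j ! k + int (length (filter
      (\<lambda>c. c ! 0 \<noteq> G0 \<and> list_weight c = w \<and> c ! j \<noteq> G0 \<and> c ! k \<noteq> G0) cs))"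
proof (induction cs arbitrary: M)
  case (Cons c cs)
  have "\<forall>r\<in>set (count_pairs w c M). length r = n"
    using Cons.prems(1,2) Cons.prems(3) [unfolded all_set_conv_all_nth]
    by (auto simp: count_pairs_def in_set_conv_nth nth_add_pairs)
  moreover have "length (count_pairs w c M) = n"
    using Cons.prems by (simp add: count_pairs_def)
  moreover have "count_pairs w c M ! j ! k = M ! j ! k
      + (if c ! 0 \<noteq> G0 \<and> list_weight c = w \<and> c ! j \<noteq> G0 \<and> c ! k \<noteq> G0 then 1 else 0)"
    using Cons.prems assms by (auto simp: count_pairs_def nth_add_pairs nth_add_row)
  ultimately show ?case
    using Cons.IH [of "count_pairs w c M"] Cons.prems by simp
qed simp

section \<open>Evaluated certificates for the automorphism group\<close>

definition permutation_candidates :: "gf4 list \<Rightarrow> nat list list" where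
  "permutation_candidates p = search (pair_table 6 p) 13"

text \<open>List form of the image of the generator under the \<open>code_map\<close> with
  permutation \<open>i \<mapsto> u * i\<close>, constant multiplier \<open>a\<close> and conjugation
  everywhere or nowhere.\<close>

definition dilate :: "nat \<Rightarrow> gf4 \<Rightarrow> bool \<Rightarrow> gf4 list \<Rightarrow> gf4 list" where
  "dilate u a b p = map (\<lambda>k. let x = a * p ! (u * k mod 13) in if b then conj4 x else x) [0..<13]"

definition code_member :: "gf4 list \<Rightarrow> gf4 list \<Rightarrow> bool" where
  "code_member w p \<longleftrightarrow> collect (=) w p \<noteq> []"

text \<open>\<open>v\<close> is the inverse of the multiplier \<open>u\<close> modulo 13. It suffices that the map sends the generator
  into the code, because it turns shifts of the generator into shifts of its image.\<close>

fun is_symmetry :: "gf4 list \<Rightarrow> nat \<times> nat \<times> gf4 \<times> bool \<Rightarrow> bool" where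
  "is_symmetry p (u, v, a, b) \<longleftrightarrow>
    u < 13 \<and> u * v mod 13 = 1 \<and> a \<noteq> G0 \<and> code_member (dilate u a b p) p"

text \<open>\<open>z\<close> is the complete zero pattern, so it fixes the support exactly.\<close>

definition vanishes_at :: "bool list \<Rightarrow> gf4 list \<Rightarrow> bool" where
  "vanishes_at z c \<longleftrightarrow> map (\<lambda>x. x = G0) c = z"

definition words_vanishing_at :: "bool list \<Rightarrow> gf4 list \<Rightarrow> gf4 list list" where
  "words_vanishing_at z p = collect vanishes_at z p"

section \<open>Counting the automorphisms\<close>

context
  fixes p :: "gf4 list"
  assumes p: "length p = 13" and gen: "circ_gen (word_of p)"
begin

lemma nth_pair_table:
  assumes "j < 13" and "k < 13"
  shows "pair_table w p ! j ! k
    = int (support_count (circ_code (word_of p)) w {0, of_nat j, of_nat k})"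
proof -
  have 0: "word_of l $ 0 = l ! 0" for l :: "gf4 list"
    using word_of_nth_of_nat [of l 0] by simp
  have "support_count (circ_code (word_of p)) w {0, of_nat j, of_nat k}
      = length (filter (\<lambda>c. c ! 0 \<noteq> G0 \<and> list_weight c = w \<and> c ! j \<noteq> G0 \<and> c ! k \<noteq> G0)
          (code_list p))"
    unfolding support_count_def using assms
    by (intro card_circ_code_filter [OF p gen])
      (auto simp: hamming_weight_word_of word_of_nth_of_nat 0 zero_gf4_def)
  then show ?thesis
    using assms length_code_list [OF p]
    by (simp add: pair_table_def fold_code_eq_fold nth_fold_count_pairs [where n = 13])
qed

lemma length_pair_table: "length (pair_table w p) = 13"
proof -
  have "length (fold (count_pairs w) cs M) = length M" for cs M
    by (induction cs arbitrary: M) (simp_all add: count_pairs_def)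
  then show ?thesis
    by (simp add: pair_table_def fold_code_eq_fold)
qed

lemma permutation_of_automorphism:
  assumes cand: "set (permutation_candidates p) \<subseteq> (\<lambda>u. map (\<lambda>k. u * k mod 13) [0..<13]) ` U"
    and \<pi>: "automorphism_over (circ_code (word_of p)) \<pi> f"
  shows "\<exists>u\<in>U. \<forall>i. \<pi> i = of_nat u * i + \<pi> 0"
proof -
  let ?M = "pair_table 6 p"
  let ?count = "support_count (circ_code (word_of p)) 6"
  define \<rho> where "\<rho> k = index13 (\<pi> (of_nat k) - \<pi> 0)" for k
  \<comment> \<open>The \<open>\<pi>\<close>-image of \<open>{0, i, j}\<close> is the translate by
    \<open>\<pi> 0\<close> of the triple on the left.\<close>
  have inv: "?count {0, \<pi> i - \<pi> 0, \<pi> j - \<pi> 0} = ?count {0, i, j}" for i j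
    using support_count_permute [OF \<pi>, of 6 "{0, i, j}"]
      support_count_translate [of "word_of p" 6 "\<pi> 0" "{0, \<pi> i - \<pi> 0, \<pi> j - \<pi> 0}"]
    by simp
  have "?M ! \<rho> i ! \<rho> j = ?M ! i ! j" if "i < 13" "j < 13" for i j
    using that by (simp add: nth_pair_table \<rho>_def inv)
  then have "map \<rho> [0..<13] \<in> set (permutation_candidates p)"
    unfolding permutation_candidates_def
    by (intro search_complete) (simp_all add: length_pair_table \<rho>_def del: index13_of_nat)
  then obtain u where u: "u \<in> U" "map \<rho> [0..<13] = map (\<lambda>k. u * k mod 13) [0..<13]"
    using cand by blast
  have "\<pi> i - \<pi> 0 = of_nat u * i" for i
  proof -
    have "\<rho> (index13 i) = u * index13 i mod 13"
      using u(2) by (simp only: map_eq_conv) simp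
    then have "index13 (\<pi> i - \<pi> 0) = index13 (of_nat (u * index13 i))"
      unfolding \<rho>_def index13_of_nat by simp
    then show ?thesis
      by (simp del: index13_of_nat)
  qed
  then show ?thesis
    using u(1) by (metis diff_add_cancel)
qed

lemma dilation_image:
  assumes "u * v mod 13 = 1" and "a \<noteq> 0" and "code_member (dilate u a b p) p"
  shows "code_map (\<lambda>i. of_nat u * i) (\<lambda>_. a) (if b then UNIV else {}) ` circ_code (word_of p)
    = circ_code (word_of p)" (is "?h ` ?C = _")
proof -
  have uv: "of_nat u * (of_nat v * i) = i" for i :: 13
    using assms(1) of_nat_13_eq_iff [of "u * v" 1] by (simp flip: mult.assoc)
  have "bij ((*) (of_nat u :: 13))"
    using uv by (intro bij_betwI [where g = "(*) (of_nat v)"]) (simp_all add: mult.left_commute)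
  then have "inj ?h"
    using assms(2) by (intro inj_code_map) simp_all
  have "?h (word_of p) = word_of (dilate u a b p)"
  proof -
    have "(word_of p) $ (of_nat u * i) = p ! (u * index13 i mod 13)" for i
      using word_of_nth_of_nat [of p "u * index13 i"] by simp
    then show ?thesis
      by (simp add: vec_eq_iff word_of_nth dilate_def code_map_nth Let_def)
  qed
  moreover have "dilate u a b p \<in> set (code_list p)"
    using assms(3) by (auto simp: code_member_def collect_eq_filter filter_empty_conv)
  ultimately have h: "?h (word_of p) \<in> ?C"
    by (auto simp: circ_code_eq_code_list [OF p])
  \<comment> \<open>\<open>u * i - t = u * (i - v * t)\<close>, as \<open>v\<close> inverts
    \<open>u\<close>.\<close>
  have "?h (shift t z) = shift (of_nat v * t) (?h z)" for t z
    by (simp add: vec_eq_iff code_map_nth right_diff_distrib uv)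
  then have "?h (shift t (word_of p)) \<in> ?C" for t
    using shift_in_circ_code [OF h] by metis
  moreover have "?h (x - y) = ?h x - ?h y" for x y
    by (simp add: vec_eq_iff code_map_nth vec_gf4_diff minus_gf4_def distrib_left conj4_add)
  ultimately have "?h ` ?C \<subseteq> ?C"
    unfolding circ_code_def by (auto elim!: group_closure_image)
  \<comment> \<open>An injective map of a finite set into itself is onto.\<close>
  then show ?thesis
    using \<open>inj ?h\<close> by (intro endo_inj_surj inj_on_subset [OF \<open>inj ?h\<close>]) simp_all
qed

text \<open>Automorphisms correspond to the affine permutations
  \<open>i \<mapsto> u * i + s\<close>: \<open>cand\<close> excludes all others, \<open>ds\<close>
  realizes these, and the word \<open>c\<close> makes each realization unique. The factor 13 counts
  the \<open>s\<close>.\<close>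

lemma card_Aut_circ_code:
  assumes cand: "permutation_candidates p = map (\<lambda>(u, _). map (\<lambda>k. u * k mod 13) [0..<13]) ds"
    and ds: "list_all (is_symmetry p) ds"
    and c: "words_vanishing_at (map (\<lambda>x. x = G0) c) p = [c]"
    and jk: "j < 13" "k < 13" "c ! j \<noteq> G0" "c ! k \<noteq> G0" "c ! j \<noteq> c ! k"
  shows "card (Aut (circ_code (word_of p))) = 13 * card (fst ` set ds)"
proof -
  let ?C = "circ_code (word_of p)"
  define U where "U = fst ` set ds"
  have U: "u < 13 \<and> (\<exists>v a b. u * v mod 13 = 1 \<and> a \<noteq> 0 \<and> code_member (dilate u a b p) p)"
    if "u \<in> U" for u
    using that ds by (fastforce simp: U_def list_all_iff zero_gf4_def)
  have candU: "set (permutation_candidates p) \<subseteq> (\<lambda>u. map (\<lambda>k. u * k mod 13) [0..<13]) ` U"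
    unfolding cand U_def by force
  define \<alpha> where "\<alpha> u s i = of_nat u * i + s" for u and s i :: 13
  have "\<exists>f. automorphism_over ?C (\<alpha> u s) f" if u: "u \<in> U" for u s
  proof -
    obtain v a b where v: "u * v mod 13 = 1" "a \<noteq> 0" "code_member (dilate u a b p) p"
      using U [OF u] by blast
    define T :: "13 set" where "T = (if b then UNIV else {})"
    have "of_nat u * (of_nat v * i) = i" for i :: 13
      using v(1) of_nat_13_eq_iff [of "u * v" 1] by (simp flip: mult.assoc)
    then have "bij (\<alpha> u s)"
      by (intro bij_betwI [where g = "\<lambda>i. of_nat v * (i - s)"])
        (simp_all add: \<alpha>_def mult.left_commute)
    \<comment> \<open>An affine permutation is realized by a shift followed by a dilation.\<close>
    have "code_map (\<alpha> u s) (\<lambda>_. a) T = code_map (\<lambda>i. of_nat u * i) (\<lambda>_. a) T \<circ> shift (- s)"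
      by (simp add: fun_eq_iff vec_eq_iff code_map_nth \<alpha>_def)
    then have "code_map (\<alpha> u s) (\<lambda>_. a) T ` ?C = ?C"
      using dilation_image [OF v] unfolding T_def [symmetric]
      by (simp only: image_comp [symmetric] shift_image_circ_code)
    then have "automorphism_over ?C (\<alpha> u s) (code_map (\<alpha> u s) (\<lambda>_. a) T)"
      using v(2) \<open>bij (\<alpha> u s)\<close> by (intro automorphism_overI) simp_all
    then show ?thesis
      by blast
  qed
  then obtain F where F: "\<And>u s. u \<in> U \<Longrightarrow> automorphism_over ?C (\<alpha> u s) (F u s)"
    by metis
  have inj: "inj_on (\<lambda>(u, s). F u s) (U \<times> UNIV)"
  proof (rule inj_onI, clarify)
    fix u s u' s' assume u: "u \<in> U" "u' \<in> U" and eq: "F u s = F u' s'"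
    \<comment> \<open>Evaluating the affine maps at 0 and 1 recovers \<open>s\<close> and
      \<open>u\<close>, the latter because multipliers are below 13.\<close>
    have "\<alpha> u s = \<alpha> u' s'"
      using F [OF u(1), of s] F [OF u(2), of s'] unfolding eq
      by (rule automorphism_over_permutation_unique)
    then have *: "of_nat u * i + s = of_nat u' * i + s'" for i
      unfolding \<alpha>_def by meson
    have "s = s'"
      using * [of 0] by simp
    moreover have "u = u'"
      using * [of 1] calculation of_nat_13_eq_iff [of u u'] U [OF u(1)] U [OF u(2)] by simp
    ultimately show "u = u' \<and> s = s'"
      by simp
  qed
  have set_c: "{d \<in> set (code_list p). map (\<lambda>x. x = G0) d = map (\<lambda>x. x = G0) c} = {c}"
    using arg_cong [OF c, of set] by (simp add: words_vanishing_at_def collect_eq_filter vanishes_at_def [abs_def])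
  then have c_in: "c \<in> set (code_list p)"
    by blast
  have c_unique: "d = word_of c" if d: "d \<in> ?C" and zero: "\<And>i. d $ i = 0 \<longleftrightarrow> word_of c $ i = 0" for d
  proof -
    obtain l where l: "l \<in> set (code_list p)" "d = word_of l"
      using d by (auto simp: circ_code_eq_code_list [OF p])
    have "l ! m = G0 \<longleftrightarrow> c ! m = G0" if "m < 13" for m
      using zero [of "of_nat m"] that l(2) by (simp add: word_of_nth_of_nat zero_gf4_def)
    then have "map (\<lambda>x. x = G0) l = map (\<lambda>x. x = G0) c"
      using length_code_list [OF p l(1)] length_code_list [OF p c_in] by (simp add: list_eq_iff_nth_eq)
    then have "l \<in> {c}"
      unfolding set_c [symmetric] using l(1) by simp
    then show ?thesis
      by (simp add: l(2))
  qed
  have uniq: "f = g" if "automorphism_over ?C \<pi> f" "automorphism_over ?C \<pi> g" for \<pi> f g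
  proof (rule automorphism_determined_by_permutation
      [OF shift_in_circ_code, where c = "word_of c" and j = "of_nat j" and k = "of_nat k"])
    show "word_of c \<in> ?C"
      using c_in by (simp add: circ_code_eq_code_list [OF p])
    show "d = word_of c" if "d \<in> ?C" "\<And>i. d $ i = 0 \<longleftrightarrow> word_of c $ i = 0" for d
      using that by (rule c_unique)
    show "word_of c $ of_nat j \<noteq> 0" "word_of c $ of_nat k \<noteq> 0"
      "word_of c $ of_nat j \<noteq> word_of c $ of_nat k"
      using jk by (simp_all add: word_of_nth_of_nat zero_gf4_def)
  qed (use that in blast)+
  have "(\<lambda>(u, s). F u s) ` (U \<times> UNIV) = Aut ?C"
  proof
    show "(\<lambda>(u, s). F u s) ` (U \<times> UNIV) \<subseteq> Aut ?C"
      using F by (auto simp: Aut_eq_automorphism_over)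
    show "Aut ?C \<subseteq> (\<lambda>(u, s). F u s) ` (U \<times> UNIV)"
    proof
      fix f assume "f \<in> Aut ?C"
      then obtain \<pi> where \<pi>: "automorphism_over ?C \<pi> f"
        by (auto simp: Aut_eq_automorphism_over)
      then obtain u where u: "u \<in> U" "\<forall>i. \<pi> i = of_nat u * i + \<pi> 0"
        using permutation_of_automorphism [OF candU] by blast
      have "\<alpha> u (\<pi> 0) = \<pi>"
        unfolding \<alpha>_def by (rule ext) (rule u(2) [rule_format, symmetric])
      then have "automorphism_over ?C \<pi> (F u (\<pi> 0))"
        using F [OF u(1), of "\<pi> 0"] by (simp only:)
      then have "f = F u (\<pi> 0)"
        by (rule uniq [OF \<pi>])
      then show "f \<in> (\<lambda>(u, s). F u s) ` (U \<times> UNIV)"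
        using u(1) by force
    qed
  qed
  then have "card (Aut ?C) = card (U \<times> (UNIV :: 13 set))"
    using card_image [OF inj] by simp
  then show ?thesis
    by (simp add: card_cartesian_product U_def)
qed

end

section \<open>The two codes\<close>

definition dilations1 :: "(nat \<times> nat \<times> gf4 \<times> bool) list" where
  "dilations1 = [(1, 1, G1, False)]"

text \<open>The multipliers are the quadratic residues modulo 13, in the order in which the search
  finds them; 1, 3, 9 form the subgroup of order 3.\<close>

definition dilations2 :: "(nat \<times> nat \<times> gf4 \<times> bool) list" where
  "dilations2 = [(1, 1, G1, False), (3, 9, G1, False), (4, 10, Gw2, True), (9, 3, G1, False),
    (10, 4, Gw2, True), (12, 12, Gw2, True)]"

lemma permutation_candidates_gen1:
  "permutation_candidates gen1 = map (\<lambda>(u, _). map (\<lambda>k. u * k mod 13) [0..<13]) dilations1"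
  by code_simp

lemma permutation_candidates_gen2:
  "permutation_candidates gen2 = map (\<lambda>(u, _). map (\<lambda>k. u * k mod 13) [0..<13]) dilations2"
  by code_simp

lemma dilations_gen1:
  "list_all (is_symmetry gen1) dilations1"
  by code_simp

lemma dilations_gen2:
  "list_all (is_symmetry gen2) dilations2"
  by code_simp

lemma unique_support_gen1: "words_vanishing_at (map (\<lambda>x. x = G0) gen1) gen1 = [gen1]"
  by code_simp

text \<open>The sum of the generator and its shift by 2. It has weight 6, while the generator itself
  has weight 10.\<close>

definition light_word2 :: "gf4 list" where
  "light_word2 = [Gw2, G1, Gw2, G0, G1, G0, G1, G0, G0, G0, G1, G0, G0]"

lemma unique_support_light_word2:
  "words_vanishing_at (map (\<lambda>x. x = G0) light_word2) gen2 = [light_word2]"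
  by code_simp

lemma card_Aut_C13_1: "card (Aut C13_1) = 13"
proof -
  have "gen1 ! 0 \<noteq> G0" "gen1 ! 1 \<noteq> G0" "gen1 ! 0 \<noteq> gen1 ! 1"
    by (simp_all add: gen1_def)
  from card_Aut_circ_code [OF good_length [OF good_gen1] good_circ_gen [OF good_gen1]
      permutation_candidates_gen1 dilations_gen1 unique_support_gen1 _ _ this]
  show ?thesis
    by (simp add: C13_1_eq dilations1_def)
qed

lemma card_Aut_C13_2: "card (Aut C13_2) = 78"
proof -
  have "light_word2 ! 0 \<noteq> G0" "light_word2 ! 1 \<noteq> G0" "light_word2 ! 0 \<noteq> light_word2 ! 1"
    by (simp_all add: light_word2_def)
  from card_Aut_circ_code [OF good_length [OF good_gen2] good_circ_gen [OF good_gen2]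
      permutation_candidates_gen2 dilations_gen2 unique_support_light_word2 _ _ this]
  show ?thesis
    by (simp add: C13_2_eq dilations2_def)
qed

theorem mainTheorem4:
  shows "(\<exists>C :: (gf4 ^ 13) set. additive_code 13 13 6 C \<and> formally_self_dual C)
    \<and> additive_code 13 13 6 C13_1 \<and> formally_self_dual C13_1
    \<and> additive_code 13 13 6 C13_2 \<and> formally_self_dual C13_2
    \<and> card (Aut C13_1) = 13
    \<and> card (Aut C13_2) = 78
    \<and> poly (weight_enumerator C13_1) 1 = W13
    \<and> poly (weight_enumerator C13_2) 1 = W13"
proof -
  have "additive_code 13 13 6 C13_1" "formally_self_dual C13_1"
    "poly (weight_enumerator C13_1) 1 = W13"
    unfolding C13_1_eq
    by (intro good_additive_code formally_self_dual_circ_code good_circ_gen good_weight_enumerator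
        good_gen1)+
  moreover have "additive_code 13 13 6 C13_2" "formally_self_dual C13_2"
    "poly (weight_enumerator C13_2) 1 = W13"
    unfolding C13_2_eq
    by (intro good_additive_code formally_self_dual_circ_code good_circ_gen good_weight_enumerator
        good_gen2)+
  ultimately show ?thesis
    using card_Aut_C13_1 card_Aut_C13_2 by blast
qed

end
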